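(* Let $D_a>0$, $L>0$. For all $\kappa,\gamma<0$ with $\kappa\ne\gamma$, the $C_0$-semigroup $(T_{A_{\kappa\gamma}}(t))_{t\ge0}$ on $\mathrm{L}^2(0,L)\times\mathrm{L}^2(0,L)$ generated by the operator $A_{\kappa\gamma}$ is not positive, where $A_{\kappa\gamma}(x,\tilde x)=\left(D_a\frac{\mathrm{d}^2x}{\mathrm{d}z^2},D_a\frac{\mathrm{d}^2\tilde x}{\mathrm{d}z^2}\right)$ for $(x,\tilde x)$ in the domain $$D(A_{\kappa\gamma})=\Big\{(x,\tilde x)\in\mathrm{H}^2(0,L)\times\mathrm{H}^2(0,L):\ \tfrac{\mathrm{d}x}{\mathrm{d}z}(0)=-\kappa\tilde x(0),\ \tfrac{\mathrm{d}\tilde x}{\mathrm{d}z}(0)=-\kappa\tilde x(0),\ \tfrac{\mathrm{d}x}{\mathrm{d}z}(L)=0,\ \tfrac{\mathrm{d}\tilde x}{\mathrm{d}z}(L)=-\gamma x(L)+\gamma\tilde x(L)\Big\}.$$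
   Context: A semigroup on $\mathrm{L}^2(0,L)\times\mathrm{L}^2(0,L)$ is positive if, for every $t\ge0$, it maps pairs of a.e. nonnegative functions to pairs of a.e. nonnegative functions. The operator $A_{\kappa\gamma}$ describes the joint dynamics of the diffusion system $\partial_tx=D_a\partial_z^2x$, $\partial_zx(0,t)+u(t)=0$, $\partial_zx(L,t)=0$, and of its observer with state $\tilde x$ and output-injection gain $\gamma$, under the observer-based feedback $u(t)=\kappa\tilde x(0,t)$. *)

theory Defs
  imports "HOL-Analysis.Analysis" "HOL-Library.Function_Algebras"
begin

instantiation "fun" :: (type, real_vector) real_vector
begin
definition scaleR_fun :: "real \<Rightarrow> ('a \<Rightarrow> 'b) \<Rightarrow> 'a \<Rightarrow> 'b"
  where "scaleR_fun c f = (\<lambda>z. c *\<^sub>R f z)"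
instance
  by standard (simp_all add: scaleR_fun_def plus_fun_def scaleR_add_right scaleR_add_left)
end

text \<open>
  A normed space is presented by a carrier \<open>X\<close> of representatives and a seminorm \<open>N\<close>;
  representatives \<open>u\<close>, \<open>v\<close> stand for the same vector iff \<open>N (u - v) = 0\<close>.
  A family \<open>T\<close> acts on representatives; linearity and boundedness make each \<open>T t\<close>
  well defined on vectors.
\<close>

definition c0_semigroup :: "'a::real_vector set \<Rightarrow> ('a \<Rightarrow> real) \<Rightarrow> (real \<Rightarrow> 'a \<Rightarrow> 'a) \<Rightarrow> bool"
  where "c0_semigroup X N T \<longleftrightarrow>
    (\<forall>t\<ge>0. \<forall>u\<in>X. T t u \<in> X) \<and>
    (\<forall>t\<ge>0. \<forall>u\<in>X. \<forall>v\<in>X. \<forall>c. N (T t (c *\<^sub>R u + v) - (c *\<^sub>R T t u + T t v)) = 0) \<and>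
    (\<forall>t\<ge>0. \<exists>C. \<forall>u\<in>X. N (T t u) \<le> C * N u) \<and>
    (\<forall>u\<in>X. N (T 0 u - u) = 0) \<and>
    (\<forall>s\<ge>0. \<forall>t\<ge>0. \<forall>u\<in>X. N (T (s + t) u - T s (T t u)) = 0) \<and>
    (\<forall>u\<in>X. ((\<lambda>t. N (T t u - u)) \<longlongrightarrow> 0) (at_right 0))"

text \<open>The (infinitesimal) generator, as a graph closed under change of representatives.\<close>

definition generator :: "'a::real_vector set \<Rightarrow> ('a \<Rightarrow> real) \<Rightarrow> (real \<Rightarrow> 'a \<Rightarrow> 'a) \<Rightarrow> ('a \<times> 'a) set"
  where "generator X N T =
    {(u, v) \<in> X \<times> X. ((\<lambda>t. N ((1 / t) *\<^sub>R (T t u - u) - v)) \<longlongrightarrow> 0) (at_right 0)}"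

text \<open>
  Elements of \<open>L\<^sup>2(0,l)\<close> are represented by functions on the whole line; their values outside
  \<open>(0,l)\<close> are irrelevant.
\<close>

definition L2 :: "real \<Rightarrow> (real \<Rightarrow> real) set"
  where "L2 l = {f. f \<in> borel_measurable (lebesgue_on {0<..<l}) \<and>
                    integrable (lebesgue_on {0<..<l}) (\<lambda>z. (f z)\<^sup>2)}"

definition L2_pair_norm :: "real \<Rightarrow> (real \<Rightarrow> real) \<times> (real \<Rightarrow> real) \<Rightarrow> real"
  where "L2_pair_norm l u =
    sqrt ((\<integral>z. (fst u z)\<^sup>2 \<partial>lebesgue_on {0<..<l}) + (\<integral>z. (snd u z)\<^sup>2 \<partial>lebesgue_on {0<..<l}))"

definition positive_semigroup ::
    "real \<Rightarrow> (real \<Rightarrow> (real \<Rightarrow> real) \<times> (real \<Rightarrow> real) \<Rightarrow> (real \<Rightarrow> real) \<times> (real \<Rightarrow> real)) \<Rightarrow> bool"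
  where "positive_semigroup l T \<longleftrightarrow>
    (\<forall>t\<ge>0. \<forall>u \<in> L2 l \<times> L2 l.
      (AE z in lebesgue_on {0<..<l}. 0 \<le> fst u z) \<and> (AE z in lebesgue_on {0<..<l}. 0 \<le> snd u z) \<longrightarrow>
      (AE z in lebesgue_on {0<..<l}. 0 \<le> fst (T t u) z) \<and>
      (AE z in lebesgue_on {0<..<l}. 0 \<le> snd (T t u) z))"

definition test_functions :: "real \<Rightarrow> (real \<Rightarrow> real) set"
  where "test_functions l =
    {\<phi>. (\<forall>n z. ((deriv ^^ n) \<phi>) field_differentiable (at z)) \<and>
        closure {z. \<phi> z \<noteq> 0} \<subseteq> {0<..<l}}"

definition has_weak_deriv :: "real \<Rightarrow> (real \<Rightarrow> real) \<Rightarrow> (real \<Rightarrow> real) \<Rightarrow> bool"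
  where "has_weak_deriv l f g \<longleftrightarrow> f \<in> L2 l \<and> g \<in> L2 l \<and>
    (\<forall>\<phi>\<in>test_functions l.
      (\<integral>z. f z * deriv \<phi> z \<partial>lebesgue_on {0<..<l}) = - (\<integral>z. g z * \<phi> z \<partial>lebesgue_on {0<..<l}))"

definition has_weak_deriv2 :: "real \<Rightarrow> (real \<Rightarrow> real) \<Rightarrow> (real \<Rightarrow> real) \<Rightarrow> bool"
  where "has_weak_deriv2 l f h \<longleftrightarrow> (\<exists>g. has_weak_deriv l f g \<and> has_weak_deriv l g h)"

definition H2 :: "real \<Rightarrow> (real \<Rightarrow> real) set"
  where "H2 l = {f. \<exists>h. has_weak_deriv2 l f h}"

text \<open>
  The value at a point of \<open>[0,l]\<close> of the representative that is continuous on \<open>[0,l]\<close>.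
  Functions with a weak derivative in \<open>L\<^sup>2(0,l)\<close> have such a representative.
\<close>

definition pt_value :: "real \<Rightarrow> (real \<Rightarrow> real) \<Rightarrow> real \<Rightarrow> real"
  where "pt_value l f c =
    (THE y. \<exists>g. continuous_on {0..l} g \<and> (AE z in lebesgue_on {0<..<l}. f z = g z) \<and> g c = y)"

definition A_dom :: "real \<Rightarrow> real \<Rightarrow> real \<Rightarrow> ((real \<Rightarrow> real) \<times> (real \<Rightarrow> real)) set"
  where "A_dom l \<kappa> \<gamma> = {(x, xt). x \<in> H2 l \<and> xt \<in> H2 l \<and>
    (\<exists>dx dxt. has_weak_deriv l x dx \<and> has_weak_deriv l xt dxt \<and>
      pt_value l dx 0 = - \<kappa> * pt_value l xt 0 \<and>
      pt_value l dxt 0 = - \<kappa> * pt_value l xt 0 \<and>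
      pt_value l dx l = 0 \<and>
      pt_value l dxt l = - \<gamma> * pt_value l x l + \<gamma> * pt_value l xt l)}"

definition A_graph ::
    "real \<Rightarrow> real \<Rightarrow> real \<Rightarrow> real \<Rightarrow>
      (((real \<Rightarrow> real) \<times> (real \<Rightarrow> real)) \<times> ((real \<Rightarrow> real) \<times> (real \<Rightarrow> real))) set"
  where "A_graph D l \<kappa> \<gamma> = {((x, xt), (y, yt)). (x, xt) \<in> A_dom l \<kappa> \<gamma> \<and> y \<in> L2 l \<and> yt \<in> L2 l \<and>
    (\<exists>ddx ddxt. has_weak_deriv2 l x ddx \<and> has_weak_deriv2 l xt ddxt \<and>
      (AE z in lebesgue_on {0<..<l}. y z = D * ddx z) \<and>
      (AE z in lebesgue_on {0<..<l}. yt z = D * ddxt z))}"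

end

theory Submission
  imports Defs
begin

text \<open>
  A positive semigroup has a positive resolvent: if \<open>\<nu>\<close> exceeds its growth bound and
  \<open>\<nu> * u - A u \<ge> 0\<close>, then \<open>u \<ge> 0\<close>. Positivity is refuted by an explicit \<open>u = (x, y)\<close> in the
  domain with \<open>\<nu> * u - A u = (0, c)\<close>, \<open>c \<ge> 0\<close>, but \<open>x < 0\<close>: the boundary condition
  \<open>x'(0) = - \<kappa> * y(0)\<close> makes the positive observer state \<open>y\<close> withdraw mass from \<open>x\<close>
  even where there is none.
\<close>

subsection \<open>Pairs of square integrable functions\<close>

text \<open>Zero first datum and slope 0 at \<open>l\<close> leave for \<open>x\<close> only
  multiples of \<open>cosh (\<mu> * (l - z))\<close>, and such a multiple has the sign opposite to
  its slope at 0. The feedback prescribes that slope as \<open>- \<kappa> * y 0\<close>, so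
  \<open>y 0 > 0\<close> makes \<open>x\<close> negative everywhere. A constant second datum gives
  just enough freedom to meet the remaining boundary conditions. This works for every \<nu> > 0, so
  the growth bound only has to be finite. The obstacle is that \<open>T\<close> is abstract and acts
  on representatives under a seminorm: no resolvent operator is constructed. The implication from
  \<nu> u - A u \<ge> 0 to u \<ge> 0 is proved for a single \<open>u\<close>, with the number
  \<open>neg_mass\<close> measuring the failure of nonnegativity. Positivity serves twice: through
  domination, for the exponential growth estimate, and to discard the image of \<nu> u - A u from a
  lower bound for the orbit.\<close>

lemma AE_summable_of_summable_integral:
  fixes f :: "nat \<Rightarrow> 'a \<Rightarrow> real"
  assumes f: "\<And>i. integrable M (f i)" and nonneg: "\<And>i x. 0 \<le> f i x"
    and "summable (\<lambda>i. integral\<^sup>L M (f i))"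
  shows "AE x in M. summable (\<lambda>i. f i x)"
proof -
  have [measurable]: "f i \<in> borel_measurable M" for i
    using f by auto
  have "(\<integral>\<^sup>+x. (\<Sum>i. ennreal (f i x)) \<partial>M) = (\<Sum>i. \<integral>\<^sup>+x. ennreal (f i x) \<partial>M)"
    by (rule nn_integral_suminf) auto
  also have "\<dots> = (\<Sum>i. ennreal (integral\<^sup>L M (f i)))"
    using f nonneg by (simp add: nn_integral_eq_integral)
  also have "\<dots> = ennreal (\<Sum>i. integral\<^sup>L M (f i))"
    using assms by (intro suminf_ennreal2) auto
  finally have "(\<integral>\<^sup>+x. (\<Sum>i. ennreal (f i x)) \<partial>M) \<noteq> \<infinity>"
    by simp
  then have "AE x in M. (\<Sum>i. ennreal (f i x)) \<noteq> \<infinity>"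
    by (intro nn_integral_PInf_AE) auto
  then show ?thesis
    by eventually_elim (use nonneg in \<open>auto intro: summable_suminf_not_top\<close>)
qed

abbreviation (input) Ioo_measure :: "real \<Rightarrow> real measure"
  where "Ioo_measure l \<equiv> lebesgue_on {0<..<l}"

lemma finite_measure_Ioo: "finite_measure (Ioo_measure l)"
proof (rule finite_measureI)
  have "emeasure lborel {0<..<l} \<noteq> \<infinity>"
    by (cases "0 \<le> l") simp_all
  then show "emeasure (Ioo_measure l) (space (Ioo_measure l)) \<noteq> \<infinity>"
    by (simp add: emeasure_restrict_space)
qed

lemma L2D:
  assumes "f \<in> L2 l"
  shows "f \<in> borel_measurable (Ioo_measure l)" "integrable (Ioo_measure l) (\<lambda>z. (f z)\<^sup>2)"
  using assms by (auto simp: L2_def)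

lemma L2_dominated:
  assumes "f \<in> borel_measurable (Ioo_measure l)" "integrable (Ioo_measure l) g"
    "\<And>z. (f z)\<^sup>2 \<le> g z"
  shows "f \<in> L2 l"
proof -
  have "integrable (Ioo_measure l) (\<lambda>z. (f z)\<^sup>2)"
  proof (rule Bochner_Integration.integrable_bound[OF assms(2)])
    show "(\<lambda>z. (f z)\<^sup>2) \<in> borel_measurable (Ioo_measure l)"
      using assms(1) by measurable
    show "AE z in Ioo_measure l. norm ((f z)\<^sup>2) \<le> norm (g z)"
      using order_trans[OF assms(3) abs_ge_self] by simp
  qed
  with assms(1) show ?thesis by (simp add: L2_def)
qed

lemma L2_add:
  assumes "f \<in> L2 l" "g \<in> L2 l" shows "f + g \<in> L2 l"
proof (rule L2_dominated)
  show "integrable (Ioo_measure l) (\<lambda>z. 2 * (f z)\<^sup>2 + 2 * (g z)\<^sup>2)"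
    using L2D(2)[OF assms(1)] L2D(2)[OF assms(2)] by simp
  show "((f + g) z)\<^sup>2 \<le> 2 * (f z)\<^sup>2 + 2 * (g z)\<^sup>2" for z
    using zero_le_power2[of "f z - g z"] by (simp add: power2_eq_square algebra_simps)
  show "f + g \<in> borel_measurable (Ioo_measure l)"
    using assms[THEN L2D(1)] by (simp add: plus_fun_def)
qed

lemma L2_scaleR:
  assumes "f \<in> L2 l" shows "c *\<^sub>R f \<in> L2 l"
  using assms[THEN L2D(1)] assms[THEN L2D(2)]
  by (auto simp: L2_def scaleR_fun_def power_mult_distrib)

lemma L2_diff:
  assumes "f \<in> L2 l" "g \<in> L2 l" shows "f - g \<in> L2 l"
  using L2_add[OF assms(1) L2_scaleR[OF assms(2), of "-1"]] by simp

text \<open>The Cauchy-Schwarz inequality against the constant 1, obtained from the nonnegative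
  variance of |f| about its mean \<open>m / l\<close>.\<close>

lemma integral_abs_le_L2:
  assumes "0 < l" and f: "f \<in> L2 l"
  shows "integrable (Ioo_measure l) (\<lambda>z. \<bar>f z\<bar>)"
    and "(\<integral>z. \<bar>f z\<bar> \<partial>Ioo_measure l) \<le> sqrt l * sqrt (\<integral>z. (f z)\<^sup>2 \<partial>Ioo_measure l)"
proof -
  interpret finite_measure "Ioo_measure l" by (rule finite_measure_Ioo)
  note [measurable] = L2D(1)[OF f]
  note f2 = L2D(2)[OF f]
  show int: "integrable (Ioo_measure l) (\<lambda>z. \<bar>f z\<bar>)"
  proof (rule Bochner_Integration.integrable_bound)
    show "integrable (Ioo_measure l) (\<lambda>z. 1 + (f z)\<^sup>2)"
      using f2 by auto
    show "AE z in Ioo_measure l. norm \<bar>f z\<bar> \<le> norm (1 + (f z)\<^sup>2)"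
    proof (intro AE_I2)
      fix z show "norm \<bar>f z\<bar> \<le> norm (1 + (f z)\<^sup>2)"
        using zero_le_power2[of "\<bar>f z\<bar> - 1/2"] by (simp add: power2_eq_square algebra_simps)
    qed
  qed auto
  define m where "m = (\<integral>z. \<bar>f z\<bar> \<partial>Ioo_measure l)"
  have [simp]: "measure (Ioo_measure l) {0<..<l} = l"
    using \<open>0 < l\<close> by (simp add: measure_restrict_space)
  have "0 \<le> (\<integral>z. (\<bar>f z\<bar> - m / l)\<^sup>2 \<partial>Ioo_measure l)"
    by simp
  also have "\<dots> = (\<integral>z. (f z)\<^sup>2 - (2 * m / l) * \<bar>f z\<bar> + (m / l)\<^sup>2 \<partial>Ioo_measure l)"
    by (intro Bochner_Integration.integral_cong) (auto simp: power2_eq_square algebra_simps)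
  also have "\<dots> = (\<integral>z. (f z)\<^sup>2 \<partial>Ioo_measure l) - (2 * m / l) * m + l * (m / l)\<^sup>2"
    using f2 int by (simp add: m_def)
  also have "\<dots> = (\<integral>z. (f z)\<^sup>2 \<partial>Ioo_measure l) - m\<^sup>2 / l"
    using \<open>0 < l\<close> by (simp add: power2_eq_square field_simps)
  finally have "m\<^sup>2 \<le> l * (\<integral>z. (f z)\<^sup>2 \<partial>Ioo_measure l)"
    using \<open>0 < l\<close> by (simp add: field_simps)
  then have "\<bar>m\<bar> \<le> sqrt (l * (\<integral>z. (f z)\<^sup>2 \<partial>Ioo_measure l))"
    by (simp add: real_le_rsqrt)
  then show "m \<le> sqrt l * sqrt (\<integral>z. (f z)\<^sup>2 \<partial>Ioo_measure l)"
    by (simp add: real_sqrt_mult)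
qed

section \<open>Seminorm, equality and order on pairs, modulo null sets\<close>

abbreviation L2_pairs :: "real \<Rightarrow> ((real \<Rightarrow> real) \<times> (real \<Rightarrow> real)) set"
  where "L2_pairs l \<equiv> L2 l \<times> L2 l"

lemma L2_pairs_intros:
  "u \<in> L2_pairs l \<Longrightarrow> v \<in> L2_pairs l \<Longrightarrow> u + v \<in> L2_pairs l"
  "u \<in> L2_pairs l \<Longrightarrow> v \<in> L2_pairs l \<Longrightarrow> u - v \<in> L2_pairs l"
  "u \<in> L2_pairs l \<Longrightarrow> c *\<^sub>R u \<in> L2_pairs l"
  by (auto simp: mem_Times_iff intro: L2_add L2_diff L2_scaleR)

text \<open>\<open>T\<close> acts on representatives and obeys its laws only up to seminorm 0. As
  relations at almost every point, several laws can be combined pointwise.\<close>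

definition AE_eq :: "real \<Rightarrow> (real \<Rightarrow> real) \<times> (real \<Rightarrow> real) \<Rightarrow> (real \<Rightarrow> real) \<times> (real \<Rightarrow> real) \<Rightarrow> bool"
  where "AE_eq l u v \<longleftrightarrow> (AE z in Ioo_measure l. fst u z = fst v z \<and> snd u z = snd v z)"

definition AE_le :: "real \<Rightarrow> (real \<Rightarrow> real) \<times> (real \<Rightarrow> real) \<Rightarrow> (real \<Rightarrow> real) \<times> (real \<Rightarrow> real) \<Rightarrow> bool"
  where "AE_le l u v \<longleftrightarrow> (AE z in Ioo_measure l. fst u z \<le> fst v z \<and> snd u z \<le> snd v z)"

lemma positive_semigroup_iff:
  "positive_semigroup l T \<longleftrightarrow> (\<forall>t\<ge>0. \<forall>u \<in> L2_pairs l. AE_le l 0 u \<longrightarrow> AE_le l 0 (T t u))"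
  by (simp add: positive_semigroup_def AE_le_def)

lemma L2_pair_norm_sq:
  "(L2_pair_norm l u)\<^sup>2 =
    (\<integral>z. (fst u z)\<^sup>2 \<partial>Ioo_measure l) + (\<integral>z. (snd u z)\<^sup>2 \<partial>Ioo_measure l)"
  by (simp add: L2_pair_norm_def)

lemma L2_pair_norm_nonneg [simp]: "0 \<le> L2_pair_norm l u"
  by (simp add: L2_pair_norm_def)

lemma L2_pair_norm_eq_0:
  assumes "u \<in> L2_pairs l" "L2_pair_norm l u = 0"
  shows "AE_eq l u 0"
proof -
  have "(\<integral>z. (fst u z)\<^sup>2 \<partial>Ioo_measure l) = 0" "(\<integral>z. (snd u z)\<^sup>2 \<partial>Ioo_measure l) = 0"
    using assms(2) by (simp_all add: L2_pair_norm_def add_nonneg_eq_0_iff)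
  moreover have "integrable (Ioo_measure l) (\<lambda>z. (fst u z)\<^sup>2)" "integrable (Ioo_measure l) (\<lambda>z. (snd u z)\<^sup>2)"
    using assms(1) by (auto simp: mem_Times_iff dest: L2D)
  ultimately have "AE z in Ioo_measure l. (fst u z)\<^sup>2 = 0" "AE z in Ioo_measure l. (snd u z)\<^sup>2 = 0"
    by (simp_all add: integral_nonneg_eq_0_iff_AE)
  then show ?thesis by (simp add: AE_eq_def)
qed

lemma L2_pairsD:
  assumes "u \<in> L2_pairs l"
  shows "integrable (Ioo_measure l) (\<lambda>z. (fst u z)\<^sup>2)" "integrable (Ioo_measure l) (\<lambda>z. (snd u z)\<^sup>2)"
  using assms by (simp_all add: mem_Times_iff L2D(2))

lemma AE_eq_of_norm_diff:
  assumes "u \<in> L2_pairs l" "v \<in> L2_pairs l" "L2_pair_norm l (u - v) = 0"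
  shows "AE_eq l u v"
  using L2_pair_norm_eq_0[OF L2_pairs_intros(2)[OF assms(1,2)] assms(3)] by (simp add: AE_eq_def)

lemma L2_pair_norm_mono:
  assumes "u \<in> L2_pairs l" "v \<in> L2_pairs l"
    and le: "AE z in Ioo_measure l. \<bar>fst u z\<bar> \<le> \<bar>fst v z\<bar> \<and> \<bar>snd u z\<bar> \<le> \<bar>snd v z\<bar>"
  shows "L2_pair_norm l u \<le> L2_pair_norm l v"
  unfolding L2_pair_norm_def
proof (intro real_sqrt_le_mono add_mono integral_mono_AE)
  show "AE z in Ioo_measure l. (fst u z)\<^sup>2 \<le> (fst v z)\<^sup>2" "AE z in Ioo_measure l. (snd u z)\<^sup>2 \<le> (snd v z)\<^sup>2"
    using le by (eventually_elim, simp add: abs_le_square_iff)+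
qed (intro L2_pairsD assms)+

lemma L2_pair_norm_cong:
  assumes "u \<in> L2_pairs l" "v \<in> L2_pairs l" "AE_eq l u v"
  shows "L2_pair_norm l u = L2_pair_norm l v"
  using assms(3) unfolding AE_eq_def
  by (intro antisym L2_pair_norm_mono assms(1,2)) auto

lemma L2_pair_norm_scaleR: "L2_pair_norm l (c *\<^sub>R u) = \<bar>c\<bar> * L2_pair_norm l u"
  by (simp add: L2_pair_norm_def scaleR_fun_def power_mult_distrib real_sqrt_mult
      flip: distrib_left)

text \<open>Integrating 2ab \<le> a^2 + b^2 gives this weak triangle inequality directly; the factor
  2 is harmless where only boundedness is at stake.\<close>

lemma L2_pair_norm_add_sq:
  assumes "u \<in> L2_pairs l" "v \<in> L2_pairs l"
  shows "(L2_pair_norm l (u + v))\<^sup>2 \<le> 2 * (L2_pair_norm l u)\<^sup>2 + 2 * (L2_pair_norm l v)\<^sup>2"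
proof -
  have "(\<integral>z. ((f + g) z)\<^sup>2 \<partial>Ioo_measure l) \<le>
      2 * (\<integral>z. (f z)\<^sup>2 \<partial>Ioo_measure l) + 2 * (\<integral>z. (g z)\<^sup>2 \<partial>Ioo_measure l)"
    if "f \<in> L2 l" "g \<in> L2 l" for f g
  proof -
    have "(\<integral>z. ((f + g) z)\<^sup>2 \<partial>Ioo_measure l) \<le> (\<integral>z. 2 * (f z)\<^sup>2 + 2 * (g z)\<^sup>2 \<partial>Ioo_measure l)"
    proof (rule integral_mono)
      show "((f + g) z)\<^sup>2 \<le> 2 * (f z)\<^sup>2 + 2 * (g z)\<^sup>2" for z
        using zero_le_power2[of "f z - g z"] by (simp add: power2_eq_square algebra_simps)
      show "integrable (Ioo_measure l) (\<lambda>z. ((f + g) z)\<^sup>2)"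
        by (rule L2D(2)[OF L2_add[OF that]])
      show "integrable (Ioo_measure l) (\<lambda>z. 2 * (f z)\<^sup>2 + 2 * (g z)\<^sup>2)"
        by (intro Bochner_Integration.integrable_add integrable_mult_right L2D(2) that)
    qed
    also have "\<dots> = 2 * (\<integral>z. (f z)\<^sup>2 \<partial>Ioo_measure l) + 2 * (\<integral>z. (g z)\<^sup>2 \<partial>Ioo_measure l)"
      using L2D(2)[OF that(1)] L2D(2)[OF that(2)] by simp
    finally show ?thesis .
  qed
  from this[of "fst u" "fst v"] this[of "snd u" "snd v"] assms show ?thesis
    by (simp add: L2_pair_norm_sq mem_Times_iff algebra_simps)
qed

text \<open>\<open>sqrt\<close> is odd on the reals. Negative arguments matter because
  \<open>suminf\<close> is unspecified where a series diverges, while \<open>L2_dominated\<close>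
  asks for its bound at every point.\<close>

lemma sqrt_power2_le_abs: "(sqrt x)\<^sup>2 \<le> \<bar>x\<bar>"
proof (cases "0 \<le> x")
  case False
  then have "(sqrt (- x))\<^sup>2 = - x" by (intro real_sqrt_pow2) simp
  with False show ?thesis by (simp only: real_sqrt_minus power2_minus)
qed simp

text \<open>The majorant is the pointwise l2 norm of the sequence; its square integrates termwise to
  the given convergent series.\<close>

lemma L2_common_bound:
  fixes f :: "nat \<Rightarrow> real \<Rightarrow> real"
  assumes f: "\<And>n. f n \<in> L2 l" and sum: "summable (\<lambda>n. \<integral>z. (f n z)\<^sup>2 \<partial>Ioo_measure l)"
  shows "\<exists>g\<in>L2 l. \<forall>n. AE z in Ioo_measure l. \<bar>f n z\<bar> \<le> g z"
proof -
  define g where "g z = sqrt (\<Sum>n. (f n z)\<^sup>2)" for z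
  note [measurable] = f[THEN L2D(1)]
  have AEs: "AE z in Ioo_measure l. summable (\<lambda>n. (f n z)\<^sup>2)"
    using f sum by (intro AE_summable_of_summable_integral) (auto dest: L2D)
  have "integrable (Ioo_measure l) (\<lambda>z. \<Sum>n. (f n z)\<^sup>2)"
    using AEs f sum by (intro integrable_suminf) (auto dest: L2D)
  moreover have "(g z)\<^sup>2 \<le> \<bar>\<Sum>n. (f n z)\<^sup>2\<bar>" for z
    unfolding g_def by (rule sqrt_power2_le_abs)
  ultimately have "g \<in> L2 l"
    by (intro L2_dominated[where g = "\<lambda>z. \<bar>\<Sum>n. (f n z)\<^sup>2\<bar>"]) (auto simp: g_def[abs_def])
  moreover have "AE z in Ioo_measure l. \<bar>f n z\<bar> \<le> g z" for n
    using AEs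
  proof eventually_elim
    case (elim z)
    have "(\<Sum>k\<in>{n}. (f k z)\<^sup>2) \<le> (\<Sum>n. (f n z)\<^sup>2)"
      using elim by (intro sum_le_suminf) auto
    then show ?case by (simp add: g_def real_le_rsqrt)
  qed
  ultimately show ?thesis by auto
qed

text \<open>The L1 norm of the negative parts. It is sublinear, controlled by the seminorm and zero
  only for nonnegative pairs, so nonnegativity can be reached by estimating a real number.\<close>

definition neg_mass :: "real \<Rightarrow> (real \<Rightarrow> real) \<times> (real \<Rightarrow> real) \<Rightarrow> real"
  where "neg_mass l u =
    (\<integral>z. max 0 (- fst u z) \<partial>Ioo_measure l) + (\<integral>z. max 0 (- snd u z) \<partial>Ioo_measure l)"

lemma integrable_neg_part_L2:
  assumes "0 < l" "f \<in> L2 l"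
  shows "integrable (Ioo_measure l) (\<lambda>z. max 0 (- f z))"
proof (rule Bochner_Integration.integrable_bound[OF integral_abs_le_L2(1)[OF assms]])
  show "(\<lambda>z. max 0 (- f z)) \<in> borel_measurable (Ioo_measure l)"
    using L2D(1)[OF assms(2)] by measurable
qed simp

lemma neg_mass_nonneg: "0 \<le> neg_mass l u"
  by (simp add: neg_mass_def)

lemma neg_mass_le_norm:
  assumes "0 < l" "u \<in> L2_pairs l"
  shows "neg_mass l u \<le> 2 * sqrt l * L2_pair_norm l u"
proof -
  have "(\<integral>z. max 0 (- f z) \<partial>Ioo_measure l) \<le> sqrt l * L2_pair_norm l u"
    if "f \<in> L2 l" "(\<integral>z. (f z)\<^sup>2 \<partial>Ioo_measure l) \<le> (L2_pair_norm l u)\<^sup>2" for f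
  proof -
    have "(\<integral>z. max 0 (- f z) \<partial>Ioo_measure l) \<le> (\<integral>z. \<bar>f z\<bar> \<partial>Ioo_measure l)"
      using integrable_neg_part_L2[OF assms(1) that(1)] integral_abs_le_L2(1)[OF assms(1) that(1)]
      by (rule integral_mono) simp
    also have "\<dots> \<le> sqrt l * sqrt (\<integral>z. (f z)\<^sup>2 \<partial>Ioo_measure l)"
      by (rule integral_abs_le_L2(2)[OF assms(1) that(1)])
    also have "\<dots> \<le> sqrt l * L2_pair_norm l u"
      using assms(1) that(2) by (intro mult_left_mono real_le_lsqrt) auto
    finally show ?thesis .
  qed
  from this[of "fst u"] this[of "snd u"] assms(2) show ?thesis
    by (simp add: neg_mass_def L2_pair_norm_sq mem_Times_iff)
qed

lemma neg_mass_subadd: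
  assumes "0 < l" "u \<in> L2_pairs l" "v \<in> L2_pairs l" "w \<in> L2_pairs l" "AE_le l (v + w) u"
  shows "neg_mass l u \<le> neg_mass l v + neg_mass l w"
proof -
  have "(\<integral>z. max 0 (- f z) \<partial>Ioo_measure l) \<le>
      (\<integral>z. max 0 (- g z) \<partial>Ioo_measure l) + (\<integral>z. max 0 (- h z) \<partial>Ioo_measure l)"
    if "f \<in> L2 l" "g \<in> L2 l" "h \<in> L2 l" "AE z in Ioo_measure l. g z + h z \<le> f z" for f g h
  proof -
    note int = that(1-3)[THEN integrable_neg_part_L2[OF assms(1)]]
    have "(\<integral>z. max 0 (- f z) \<partial>Ioo_measure l) \<le>
        (\<integral>z. max 0 (- g z) + max 0 (- h z) \<partial>Ioo_measure l)"
    proof (rule integral_mono_AE)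
      show "AE z in Ioo_measure l. max 0 (- f z) \<le> max 0 (- g z) + max 0 (- h z)"
        using that(4) by eventually_elim auto
    qed (intro Bochner_Integration.integrable_add int)+
    also have "\<dots> = (\<integral>z. max 0 (- g z) \<partial>Ioo_measure l) + (\<integral>z. max 0 (- h z) \<partial>Ioo_measure l)"
      using int by (intro Bochner_Integration.integral_add)
    finally show ?thesis .
  qed
  from this[of "fst u" "fst v" "fst w"] this[of "snd u" "snd v" "snd w"] assms show ?thesis
    by (simp add: neg_mass_def AE_le_def mem_Times_iff)
qed

lemma neg_mass_cong:
  assumes "u \<in> L2_pairs l" "v \<in> L2_pairs l" "AE_eq l u v"
  shows "neg_mass l u = neg_mass l v"
proof -
  have [measurable]: "fst u \<in> borel_measurable (Ioo_measure l)" "snd u \<in> borel_measurable (Ioo_measure l)"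
    "fst v \<in> borel_measurable (Ioo_measure l)" "snd v \<in> borel_measurable (Ioo_measure l)"
    using assms(1,2) by (auto simp: mem_Times_iff intro: L2D(1))
  have AEs: "AE z in Ioo_measure l. fst u z = fst v z" "AE z in Ioo_measure l. snd u z = snd v z"
    using assms(3) by (auto simp: AE_eq_def)
  have "(\<integral>z. max 0 (- fst u z) \<partial>Ioo_measure l) = (\<integral>z. max 0 (- fst v z) \<partial>Ioo_measure l)"
  proof (rule integral_cong_AE)
    show "AE z in Ioo_measure l. max 0 (- fst u z) = max 0 (- fst v z)"
      using AEs(1) by eventually_elim simp
  qed measurable
  moreover have "(\<integral>z. max 0 (- snd u z) \<partial>Ioo_measure l) = (\<integral>z. max 0 (- snd v z) \<partial>Ioo_measure l)"
  proof (rule integral_cong_AE)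
    show "AE z in Ioo_measure l. max 0 (- snd u z) = max 0 (- snd v z)"
      using AEs(2) by eventually_elim simp
  qed measurable
  ultimately show ?thesis by (simp add: neg_mass_def)
qed

lemma neg_mass_scaleR: "0 \<le> c \<Longrightarrow> neg_mass l (c *\<^sub>R u) = c * neg_mass l u"
proof -
  assume "0 \<le> c"
  then have *: "max 0 (- (c * a)) = c * max 0 (- a)" for a :: real
    by (simp add: max_mult_distrib_left)
  show ?thesis
    by (simp add: neg_mass_def scaleR_fun_def * distrib_left)
qed

lemma neg_mass_eq_0_imp:
  assumes "0 < l" "u \<in> L2_pairs l" "neg_mass l u = 0"
  shows "AE_le l 0 u"
proof -
  have "(\<integral>z. max 0 (- fst u z) \<partial>Ioo_measure l) = 0" "(\<integral>z. max 0 (- snd u z) \<partial>Ioo_measure l) = 0"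
    using assms(3) by (simp_all add: neg_mass_def add_nonneg_eq_0_iff)
  then have "AE z in Ioo_measure l. max 0 (- fst u z) = 0" "AE z in Ioo_measure l. max 0 (- snd u z) = 0"
    using assms by (simp_all add: integral_nonneg_eq_0_iff_AE integrable_neg_part_L2 mem_Times_iff)
  then show ?thesis
    unfolding AE_le_def by eventually_elim auto
qed

subsection \<open>Positive semigroups\<close>

locale positive_L2_semigroup =
  fixes l :: real and T :: "real \<Rightarrow> (real \<Rightarrow> real) \<times> (real \<Rightarrow> real) \<Rightarrow> (real \<Rightarrow> real) \<times> (real \<Rightarrow> real)"
  assumes l_pos: "0 < l"
    and semigroup: "c0_semigroup (L2_pairs l) (L2_pair_norm l) T"
    and positive: "positive_semigroup l T"
begin

abbreviation "X \<equiv> L2_pairs l"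
abbreviation "N \<equiv> L2_pair_norm l"

section \<open>The semigroup laws as relations almost everywhere\<close>

lemma T_mem: "0 \<le> t \<Longrightarrow> u \<in> X \<Longrightarrow> T t u \<in> X"
  using semigroup unfolding c0_semigroup_def by blast

lemma T_bounded: "0 \<le> t \<Longrightarrow> \<exists>C. \<forall>u\<in>X. N (T t u) \<le> C * N u"
  using semigroup unfolding c0_semigroup_def by blast

lemma T_linear:
  assumes "0 \<le> t" "u \<in> X" "v \<in> X"
  shows "AE_eq l (T t (c *\<^sub>R u + v)) (c *\<^sub>R T t u + T t v)"
proof (rule AE_eq_of_norm_diff)
  show "N (T t (c *\<^sub>R u + v) - (c *\<^sub>R T t u + T t v)) = 0"
    using semigroup assms unfolding c0_semigroup_def by blast
qed (intro T_mem L2_pairs_intros assms)+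

lemma T_zero:
  assumes "u \<in> X" shows "AE_eq l (T 0 u) u"
proof (rule AE_eq_of_norm_diff)
  show "N (T 0 u - u) = 0"
    using semigroup assms unfolding c0_semigroup_def by blast
qed (auto intro: T_mem assms)

lemma T_add:
  assumes "0 \<le> s" "0 \<le> t" "u \<in> X" shows "AE_eq l (T (s + t) u) (T s (T t u))"
proof (rule AE_eq_of_norm_diff)
  show "N (T (s + t) u - T s (T t u)) = 0"
    using semigroup assms unfolding c0_semigroup_def by blast
qed (auto intro: T_mem assms add_nonneg_nonneg)

lemma T_cont: "u \<in> X \<Longrightarrow> ((\<lambda>t. N (T t u - u)) \<longlongrightarrow> 0) (at_right 0)"
  using semigroup unfolding c0_semigroup_def by blast

lemma T_nonneg: "0 \<le> t \<Longrightarrow> u \<in> X \<Longrightarrow> AE_le l 0 u \<Longrightarrow> AE_le l 0 (T t u)"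
  using positive unfolding positive_semigroup_iff by blast

text \<open>Positivity applied to \<open>v + u\<close> and \<open>v - u\<close> bounds the absolute
  values of \<open>T t u\<close> by \<open>T t v\<close>, and the seminorm is monotone in absolute
  values.\<close>

lemma T_dominated:
  assumes t: "0 \<le> t" and X: "u \<in> X" "v \<in> X"
    and le: "AE z in Ioo_measure l. \<bar>fst u z\<bar> \<le> fst v z \<and> \<bar>snd u z\<bar> \<le> snd v z"
  shows "N (T t u) \<le> N (T t v)"
proof (rule L2_pair_norm_mono)
  have key: "AE_le l 0 (c *\<^sub>R T t u + T t v)" if "\<bar>c\<bar> = 1" for c
  proof -
    have "AE_le l 0 (c *\<^sub>R u + v)"
      unfolding AE_le_def using le
      by eventually_elim (use that in \<open>auto simp: scaleR_fun_def abs_if split: if_splits\<close>)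
    then have "AE_le l 0 (T t (c *\<^sub>R u + v))"
      by (intro T_nonneg t L2_pairs_intros X)
    then show ?thesis
      using T_linear[OF t X, of c] unfolding AE_le_def AE_eq_def by eventually_elim auto
  qed
  have "AE_le l 0 (1 *\<^sub>R T t u + T t v)" "AE_le l 0 ((- 1) *\<^sub>R T t u + T t v)"
    by (rule key, simp)+
  then show "AE z in Ioo_measure l. \<bar>fst (T t u) z\<bar> \<le> \<bar>fst (T t v) z\<bar> \<and> \<bar>snd (T t u) z\<bar> \<le> \<bar>snd (T t v) z\<bar>"
    unfolding AE_le_def by eventually_elim (auto simp: scaleR_fun_def)
qed (auto intro: T_mem t X)

text \<open>
  Positivity replaces the uniform boundedness principle: vectors \<open>w n\<close> on which the norms of
  \<open>T (\<tau> n)\<close> blow up have a common majorant \<open>v\<close>, along which \<open>T\<close> would not be continuous at \<open>0\<close>.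
\<close>

lemma locally_bounded: "\<exists>\<delta>>0. \<exists>M. \<forall>t u. 0 < t \<longrightarrow> t \<le> \<delta> \<longrightarrow> u \<in> X \<longrightarrow> N (T t u) \<le> M * N u"
proof (rule ccontr)
  assume neg: "\<not> ?thesis"
  have "\<exists>t w. 0 < t \<and> t \<le> 1 / real (Suc n) \<and> w \<in> X \<and> N w = (1 / 2) ^ n \<and> 2 ^ n < N (T t w)" for n
  proof -
    from neg have "\<not> (\<forall>t u. 0 < t \<longrightarrow> t \<le> 1 / real (Suc n) \<longrightarrow> u \<in> X \<longrightarrow> N (T t u) \<le> 4 ^ n * N u)"
      by (metis of_nat_0_less_iff zero_less_Suc zero_less_divide_1_iff)
    then obtain t u where t: "0 < t" "t \<le> 1 / real (Suc n)" and u: "u \<in> X"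
      and big: "4 ^ n * N u < N (T t u)"
      by (auto simp: not_le)
    \<comment> \<open>Boundedness of the single operator \<open>T t\<close> excludes a
      representative of the zero vector, so \<open>u\<close> can be normalised.\<close>
    obtain C where "N (T t u) \<le> C * N u"
      using T_bounded[of t] t u by auto
    with big have "N u \<noteq> 0" by auto
    then have Nu: "0 < N u" using L2_pair_norm_nonneg[of l u] by linarith
    \<comment> \<open>Scaling to norm (1/2)^n makes the squared norms summable, and the factor 4^n
      still leaves an image of norm above 2^n.\<close>
    define c where "c = (1 / 2) ^ n / N u"
    have c: "0 < c" using Nu by (simp add: c_def)
    have "N (c *\<^sub>R T t u) = N (T t (c *\<^sub>R u))"
    proof (rule L2_pair_norm_cong)
      \<comment> \<open>Homogeneity has to come from the law for \<open>c *\<^sub>R u + v\<close>;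
        splitting off one copy of \<open>u\<close> avoids the image of 0.\<close>
      have eq: "(c - 1) *\<^sub>R x + x = c *\<^sub>R x" for x :: "(real \<Rightarrow> real) \<times> (real \<Rightarrow> real)"
        by (simp add: scaleR_diff_left)
      have "AE_eq l (T t ((c - 1) *\<^sub>R u + u)) ((c - 1) *\<^sub>R T t u + T t u)"
        using t u by (intro T_linear) auto
      then show "AE_eq l (c *\<^sub>R T t u) (T t (c *\<^sub>R u))"
        unfolding eq by (simp add: AE_eq_def eq_commute)
    qed (use t u in \<open>auto intro!: L2_pairs_intros(3) T_mem\<close>)
    then have "N (T t (c *\<^sub>R u)) = c * N (T t u)"
      using c by (simp add: L2_pair_norm_scaleR)
    also have "\<dots> > c * (4 ^ n * N u)"
      using big c by simp
    also have "c * (4 ^ n * N u) = 2 ^ n"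
      using Nu by (simp add: c_def flip: power_mult_distrib power_divide)
    finally have "2 ^ n < N (T t (c *\<^sub>R u))" .
    moreover have "N (c *\<^sub>R u) = (1 / 2) ^ n"
      using c Nu by (simp add: L2_pair_norm_scaleR c_def)
    ultimately show ?thesis
      using t u by (blast intro: L2_pairs_intros(3))
  qed
  then obtain \<tau> w where \<tau>: "\<And>n. 0 < \<tau> n" "\<And>n. \<tau> n \<le> 1 / real (Suc n)"
    and w: "\<And>n. w n \<in> X" "\<And>n. N (w n) = (1 / 2) ^ n" and big: "\<And>n. 2 ^ n < N (T (\<tau> n) (w n))"
    by metis
  have sq: "(\<integral>z. (fst (w n) z)\<^sup>2 \<partial>Ioo_measure l) + (\<integral>z. (snd (w n) z)\<^sup>2 \<partial>Ioo_measure l) = (1 / 4) ^ n" for n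
  proof -
    have "((1 / 2) ^ n)\<^sup>2 = ((1 / 2)\<^sup>2 :: real) ^ n"
      by (simp only: power_mult[symmetric] mult.commute)
    then show ?thesis
      using L2_pair_norm_sq[of l "w n"] w(2)[of n] by (simp add: power2_eq_square)
  qed
  have "summable (\<lambda>n. (1 / 4 :: real) ^ n)"
    by (rule summable_geometric) simp
  then have "summable (\<lambda>n. \<integral>z. (fst (w n) z)\<^sup>2 \<partial>Ioo_measure l)" "summable (\<lambda>n. \<integral>z. (snd (w n) z)\<^sup>2 \<partial>Ioo_measure l)"
    by (rule summable_comparison_test', simp flip: sq)+
  moreover have "fst (w n) \<in> L2 l" "snd (w n) \<in> L2 l" for n
    using w(1)[of n] by (auto simp: mem_Times_iff)
  ultimately obtain g h where gh: "g \<in> L2 l" "h \<in> L2 l"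
    "\<And>n. AE z in Ioo_measure l. \<bar>fst (w n) z\<bar> \<le> g z" "\<And>n. AE z in Ioo_measure l. \<bar>snd (w n) z\<bar> \<le> h z"
    using L2_common_bound[of "\<lambda>n. fst (w n)" l] L2_common_bound[of "\<lambda>n. snd (w n)" l] by blast
  define v where "v = (g, h)"
  have v: "v \<in> X" using gh by (simp add: v_def)
  have ge: "2 ^ n < N (T (\<tau> n) v)" for n
  proof -
    have "N (T (\<tau> n) (w n)) \<le> N (T (\<tau> n) v)"
      using \<tau>(1)[of n] w(1) v gh(3)[of n] gh(4)[of n] by (intro T_dominated) (auto simp: v_def)
    with big[of n] show ?thesis by linarith
  qed
  have "\<tau> \<longlonglongrightarrow> 0"
  proof (rule tendsto_sandwich)
    show "\<forall>\<^sub>F n in sequentially. 0 \<le> \<tau> n" "\<forall>\<^sub>F n in sequentially. \<tau> n \<le> 1 / real (Suc n)"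
      using less_imp_le[OF \<tau>(1)] \<tau>(2) by (simp_all del: of_nat_Suc)
    show "(\<lambda>n. 1 / real (Suc n)) \<longlonglongrightarrow> 0"
      using LIMSEQ_inverse_real_of_nat by (simp add: inverse_eq_divide)
  qed simp
  then have "filterlim \<tau> (at_right 0) sequentially"
    using \<tau>(1) less_imp_neq[OF \<tau>(1)] by (simp add: filterlim_at)
  from filterlim_compose[OF T_cont[OF v] this]
  have "\<forall>\<^sub>F n in sequentially. N (T (\<tau> n) v - v) < 1"
    by (rule order_tendstoD) simp
  moreover have "\<forall>\<^sub>F n in sequentially. 2 + 2 * (N v)\<^sup>2 < 4 ^ n"
  proof -
    obtain m :: nat where "2 + 2 * (N v)\<^sup>2 < 4 ^ m"
      using real_arch_pow[of 4] by auto
    then have "2 + 2 * (N v)\<^sup>2 < 4 ^ n" if "m \<le> n" for n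
      using power_increasing[OF that, of "4 :: real"] by linarith
    then show ?thesis by (auto simp: eventually_sequentially)
  qed
  ultimately have "\<forall>\<^sub>F n :: nat in sequentially. False"
  proof eventually_elim
    case (elim n)
    have "4 ^ n = (2 ^ n :: real)\<^sup>2"
      by (simp add: power2_eq_square flip: power_mult_distrib)
    also have "\<dots> \<le> (N ((T (\<tau> n) v - v) + v))\<^sup>2"
      using ge[of n] by (intro power_mono) auto
    also have "\<dots> \<le> 2 * (N (T (\<tau> n) v - v))\<^sup>2 + 2 * (N v)\<^sup>2"
      using \<tau>(1)[of n] v by (intro L2_pair_norm_add_sq L2_pairs_intros(2) T_mem) auto
    also have "\<dots> \<le> 2 * 1 + 2 * (N v)\<^sup>2"
      using elim(1) by (intro add_mono mult_left_mono) (auto simp: power_le_one)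
    finally show False using elim(2) by linarith
  qed
  then show False by simp
qed

text \<open>Time is covered by steps of length \<delta>, each costing a factor \<open>M\<close>;
  growth by \<open>M\<close> per \<delta> is growth at the rate
  \<open>ln M / \<delta>\<close>.\<close>

lemma exponential_growth:
  "\<exists>M \<omega>. 0 \<le> M \<and> (\<forall>t\<ge>0. \<forall>u\<in>X. N (T t u) \<le> M * exp (\<omega> * t) * N u)"
proof -
  obtain \<delta> M\<^sub>0 where \<delta>: "0 < \<delta>" and M0: "\<And>t u. 0 < t \<Longrightarrow> t \<le> \<delta> \<Longrightarrow> u \<in> X \<Longrightarrow> N (T t u) \<le> M\<^sub>0 * N u"
    using locally_bounded by blast
  define M where "M = max 1 M\<^sub>0"
  have M: "1 \<le> M" by (simp add: M_def)
  have base: "N (T t u) \<le> M * N u" if "0 \<le> t" "t \<le> \<delta>" "u \<in> X" for t u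
  proof (cases "t = 0")
    case True
    have "N (T 0 u) = 1 * N u"
      using that by (simp add: L2_pair_norm_cong[OF T_mem _ T_zero])
    also have "\<dots> \<le> M * N u" by (intro mult_right_mono M) simp
    finally show ?thesis using True by simp
  next
    case False
    then have "N (T t u) \<le> M\<^sub>0 * N u" using M0 that by simp
    also have "\<dots> \<le> M * N u" by (intro mult_right_mono) (simp_all add: M_def)
    finally show ?thesis .
  qed
  have step: "N (T t u) \<le> M ^ Suc n * N u" if "0 \<le> t" "t \<le> real (Suc n) * \<delta>" "u \<in> X" for n t u
    using that
  proof (induction n arbitrary: t u)
    case 0
    then show ?case using base by simp
  next
    case (Suc n)
    show ?case
    proof (cases "t \<le> \<delta>")
      case True
      then have "N (T t u) \<le> M * N u" using base Suc.prems by simp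
      also have "\<dots> \<le> M ^ Suc (Suc n) * N u"
        using M self_le_power[of M "Suc (Suc n)"] by (intro mult_right_mono) auto
      finally show ?thesis .
    next
      case False
      have "AE_eq l (T ((t - \<delta>) + \<delta>) u) (T (t - \<delta>) (T \<delta> u))"
        using False \<delta> Suc.prems by (intro T_add) auto
      then have "N (T t u) = N (T (t - \<delta>) (T \<delta> u))"
        using False \<delta> Suc.prems by (intro L2_pair_norm_cong T_mem) auto
      also have "\<dots> \<le> M ^ Suc n * N (T \<delta> u)"
        using False \<delta> Suc.prems by (intro Suc.IH T_mem) (auto simp: algebra_simps)
      also have "\<dots> \<le> M ^ Suc n * (M * N u)"
        using \<delta> M Suc.prems by (intro mult_left_mono base) auto
      finally show ?thesis by (simp add: mult_ac)
    qed
  qed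
  have "N (T t u) \<le> M * exp (ln M / \<delta> * t) * N u" if "0 \<le> t" "u \<in> X" for t u
  proof -
    \<comment> \<open>Rounding down leaves a last incomplete step, hence \<open>Suc n\<close> steps
      and the leading factor \<open>M\<close>.\<close>
    define n where "n = nat \<lfloor>t / \<delta>\<rfloor>"
    have n: "real n \<le> t / \<delta>" "t / \<delta> \<le> real (Suc n)"
      using that \<delta> by (simp_all add: n_def) linarith
    have "N (T t u) \<le> M * M ^ n * N u"
      using step[of t n u] that n(2) \<delta> by (simp add: pos_divide_le_eq)
    also have "M ^ n = exp (real n * ln M)"
      using M by (simp add: exp_of_nat_mult)
    also have "M * exp (real n * ln M) * N u \<le> M * exp (ln M / \<delta> * t) * N u"
      using M mult_right_mono[OF n(1), of "ln M"]
      by (intro mult_right_mono mult_left_mono) (simp_all add: mult.commute)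
    finally show ?thesis .
  qed
  with M show ?thesis by (intro exI[of _ M] exI[of _ "ln M / \<delta>"]) auto
qed

text \<open>
  The resolvent of a positive semigroup is positive. No orbit is integrated: the quantity
  \<open>P = (SUP t\<ge>0. exp (- \<omega> * t) * neg_mass l (T t u))\<close> satisfies
  \<open>P * (1 + \<nu> * h) \<le> P * exp (\<omega> * h) + o(h)\<close>, which forces \<open>P \<le> 0\<close> when \<open>\<omega> < \<nu>\<close>.
\<close>

lemma nonneg_of_resolvent_nonneg:
  assumes "0 \<le> M" and growth: "\<And>t u. 0 \<le> t \<Longrightarrow> u \<in> X \<Longrightarrow> N (T t u) \<le> M * exp (\<omega> * t) * N u"
    and gen: "(u, w) \<in> generator X N T" and \<nu>: "0 < \<nu>" "\<omega> < \<nu>"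
    and f: "AE_le l 0 (\<nu> *\<^sub>R u - w)"
  shows "AE_le l 0 u"
proof -
  have u: "u \<in> X" and w: "w \<in> X"
    and lim: "((\<lambda>h. N ((1 / h) *\<^sub>R (T h u - u) - w)) \<longlongrightarrow> 0) (at_right 0)"
    using gen by (auto simp: generator_def)
  define K where "K = 2 * sqrt l * M"
  have K: "0 \<le> K" using l_pos \<open>0 \<le> M\<close> by (simp add: K_def)
  have p_le: "neg_mass l (T t v) \<le> K * exp (\<omega> * t) * N v" if "0 \<le> t" "v \<in> X" for t v
  proof -
    have "neg_mass l (T t v) \<le> 2 * sqrt l * N (T t v)"
      by (intro neg_mass_le_norm l_pos T_mem that)
    also have "\<dots> \<le> 2 * sqrt l * (M * exp (\<omega> * t) * N v)"
      using l_pos by (intro mult_left_mono growth that) auto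
    finally show ?thesis by (simp add: K_def mult_ac)
  qed
  \<comment> \<open>The weight \<open>exp (- \<omega> * t)\<close> cancels the growth of the orbit,
    so the supremum \<open>P\<close> is finite.\<close>
  define q where "q t = exp (- \<omega> * t) * neg_mass l (T t u)" for t
  define P where "P = (SUP t\<in>{0..}. q t)"
  have q_le: "q t \<le> K * N u" if "0 \<le> t" for t
    using mult_left_mono[OF p_le[OF that u], of "exp (- \<omega> * t)"]
    by (simp add: q_def mult_ac exp_minus flip: exp_add)
  then have q_P: "q t \<le> P" if "0 \<le> t" for t
    unfolding P_def using that by (intro cSUP_upper bdd_aboveI[of _ "K * N u"]) auto
  have main: "P * (\<nu> - (exp (\<omega> * h) - 1) / h) \<le> K * N ((1 / h) *\<^sub>R (T h u - u) - w)" if h: "0 < h" for h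
  proof -
    \<comment> \<open>The defect of the difference quotient: \<open>T h u\<close> is
      \<open>u + h *\<^sub>R w + h *\<^sub>R r\<close>, and \<open>N r\<close> tends to 0 with
      \<open>h\<close>.\<close>
    define r where "r = (1 / h) *\<^sub>R (T h u - u) - w"
    have r: "r \<in> X" unfolding r_def by (intro L2_pairs_intros T_mem u w) (use h in auto)
    have fX: "\<nu> *\<^sub>R u - w \<in> X" by (intro L2_pairs_intros u w)
    have Thu: "T h u \<in> X" using h u by (auto intro: T_mem)
    define y where "y = (- h) *\<^sub>R r + T h u"
    have y: "y \<in> X" unfolding y_def by (intro L2_pairs_intros r Thu)
    have split: "(\<nu> * h) *\<^sub>R u + u = h *\<^sub>R (\<nu> *\<^sub>R u - w) + y"
      using h by (simp add: y_def r_def algebra_simps)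
    have "(1 + \<nu> * h) * q t \<le> h * K * N r + exp (\<omega> * h) * P" if t: "0 \<le> t" for t
    proof -
      have mem: "T t u \<in> X" "T t r \<in> X" "T (t + h) u \<in> X"
        using t h u r by (auto intro!: T_mem)
      \<comment> \<open>\<open>neg_mass\<close> is homogeneous only for nonnegative factors: the
        sign stays with \<open>T t r\<close>, and the small factor \<open>h\<close> can be pulled
        out.\<close>
      have "AE_le l (h *\<^sub>R ((- 1) *\<^sub>R T t r) + T (t + h) u) ((1 + \<nu> * h) *\<^sub>R T t u)"
        using T_linear[OF t u u, of "\<nu> * h"] T_linear[OF t fX y, of h]
          T_linear[OF t r Thu, of "- h", folded y_def] T_add[OF t less_imp_le[OF h] u]
          T_nonneg[OF t fX f]
        unfolding AE_le_def AE_eq_def split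
      proof eventually_elim
        case (elim z)
        have "0 \<le> h * fst (T t (\<nu> *\<^sub>R u - w)) z" "0 \<le> h * snd (T t (\<nu> *\<^sub>R u - w)) z"
          using elim h by auto
        with elim show ?case by (auto simp: scaleR_fun_def algebra_simps)
      qed
      then have "neg_mass l ((1 + \<nu> * h) *\<^sub>R T t u) \<le>
          neg_mass l (h *\<^sub>R ((- 1) *\<^sub>R T t r)) + neg_mass l (T (t + h) u)"
        by (intro neg_mass_subadd l_pos L2_pairs_intros mem)
      then have "(1 + \<nu> * h) * neg_mass l (T t u) \<le>
          h * neg_mass l ((- 1) *\<^sub>R T t r) + neg_mass l (T (t + h) u)"
        using h \<nu> by (simp only: neg_mass_scaleR less_imp_le add_nonneg_nonneg mult_nonneg_nonneg zero_le_one)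
      moreover have "h * neg_mass l ((- 1) *\<^sub>R T t r) \<le> h * (K * exp (\<omega> * t) * N r)"
      proof (rule mult_left_mono)
        have "neg_mass l ((- 1) *\<^sub>R T t r) \<le> 2 * sqrt l * N ((- 1) *\<^sub>R T t r)"
          by (intro neg_mass_le_norm l_pos L2_pairs_intros(3)[OF mem(2)])
        also have "\<dots> = 2 * sqrt l * N (T t r)"
          by (simp add: L2_pair_norm_scaleR del: scaleR_minus1_left scaleR_minus_left)
        also have "\<dots> \<le> 2 * sqrt l * (M * exp (\<omega> * t) * N r)"
          using l_pos by (intro mult_left_mono growth t r) auto
        finally show "neg_mass l ((- 1) *\<^sub>R T t r) \<le> K * exp (\<omega> * t) * N r"
          by (simp add: K_def mult_ac)
      qed (use h in simp)
      moreover have "neg_mass l (T (t + h) u) \<le> exp (\<omega> * (t + h)) * P"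
        using mult_left_mono[OF q_P[of "t + h"], of "exp (\<omega> * (t + h))"] t h
        by (simp add: q_def exp_minus flip: exp_add mult.assoc)
      ultimately have "(1 + \<nu> * h) * neg_mass l (T t u) \<le>
          exp (\<omega> * t) * (h * K * N r + exp (\<omega> * h) * P)"
        by (simp add: algebra_simps exp_add)
      then have "exp (- \<omega> * t) * ((1 + \<nu> * h) * neg_mass l (T t u)) \<le>
          exp (- \<omega> * t) * (exp (\<omega> * t) * (h * K * N r + exp (\<omega> * h) * P))"
        by (intro mult_left_mono) auto
      also have "\<dots> = h * K * N r + exp (\<omega> * h) * P"
        by (simp add: exp_minus flip: mult.assoc exp_add)
      finally show ?thesis by (simp add: q_def mult_ac)
    qed
    then have "P \<le> (h * K * N r + exp (\<omega> * h) * P) / (1 + \<nu> * h)"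
      unfolding P_def using h \<nu>
      by (intro cSUP_least) (auto simp: pos_le_divide_eq add_pos_pos mult.commute)
    then have "P * (1 + \<nu> * h) \<le> h * K * N r + exp (\<omega> * h) * P"
      using h \<nu> by (simp add: pos_le_divide_eq add_pos_pos)
    then show ?thesis
      using h unfolding r_def[symmetric] by (simp add: field_simps)
  qed
  have "((\<lambda>h. (exp (\<omega> * h) - 1) / h) \<longlongrightarrow> \<omega>) (at_right 0)"
  proof -
    have "((\<lambda>h. exp (\<omega> * h)) has_real_derivative \<omega>) (at 0)"
      by (auto intro!: derivative_eq_intros)
    then show ?thesis
      by (auto simp: DERIV_def intro: tendsto_mono[OF at_le])
  qed
  then have lim_l: "((\<lambda>h. P * (\<nu> - (exp (\<omega> * h) - 1) / h)) \<longlongrightarrow> P * (\<nu> - \<omega>)) (at_right 0)"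
    by (intro tendsto_intros)
  have lim_r: "((\<lambda>h. K * N ((1 / h) *\<^sub>R (T h u - u) - w)) \<longlongrightarrow> K * 0) (at_right 0)"
    by (intro tendsto_intros lim)
  have "P * (\<nu> - \<omega>) \<le> K * 0"
  proof (rule tendsto_le[OF _ lim_r lim_l])
    show "\<forall>\<^sub>F h in at_right 0. P * (\<nu> - (exp (\<omega> * h) - 1) / h) \<le> K * N ((1 / h) *\<^sub>R (T h u - u) - w)"
      using main by (auto simp: eventually_at_right_field intro!: exI[of _ 1])
  qed simp
  then have "P \<le> 0"
    using \<nu> by (simp add: mult_le_0_iff)
  then have "neg_mass l (T 0 u) \<le> 0"
    using q_P[of 0] by (simp add: q_def)
  moreover have "neg_mass l (T 0 u) = neg_mass l u"
    by (intro neg_mass_cong T_mem T_zero u) simp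
  ultimately have "neg_mass l u = 0"
    using neg_mass_nonneg[of l u] by linarith
  then show ?thesis
    by (rule neg_mass_eq_0_imp[OF l_pos u])
qed

end

subsection \<open>Classical solutions in the domain\<close>

lemma continuous_L2:
  assumes "0 < l" "continuous_on UNIV f" shows "f \<in> L2 l"
proof -
  have meas: "g \<in> borel_measurable (Ioo_measure l)" if "continuous_on UNIV g" for g :: "real \<Rightarrow> real"
    by (rule continuous_imp_measurable_on_sets_lebesgue)
      (auto intro: continuous_on_subset[OF that])
  have "compact ((\<lambda>z. (f z)\<^sup>2) ` {0..l})"
    by (intro compact_continuous_image continuous_intros continuous_on_subset[OF assms(2)]) auto
  then have "bounded ((\<lambda>z. (f z)\<^sup>2) ` {0..l})"
    by (rule compact_imp_bounded)
  then obtain B where B: "\<forall>z\<in>{0..l}. (f z)\<^sup>2 \<le> B"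
    by (auto simp: bounded_iff)
  interpret finite_measure "Ioo_measure l" by (rule finite_measure_Ioo)
  have "integrable (Ioo_measure l) (\<lambda>z. (f z)\<^sup>2)"
  proof (rule integrable_const_bound)
    show "AE z in Ioo_measure l. norm ((f z)\<^sup>2) \<le> B"
      by (rule AE_I2) (use B in auto)
    show "(\<lambda>z. (f z)\<^sup>2) \<in> borel_measurable (Ioo_measure l)"
      by (intro meas continuous_intros assms)
  qed
  with meas[OF assms(2)] show ?thesis by (simp add: L2_def)
qed

lemma continuous_integrable_Ioo:
  fixes f :: "real \<Rightarrow> real"
  assumes "0 < l" "continuous_on UNIV f"
  shows "integrable (Ioo_measure l) f"
proof -
  have "f \<in> L2 l" by (rule continuous_L2[OF assms])
  from integral_abs_le_L2(1)[OF assms(1) this] L2D(1)[OF this] show ?thesis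
    by (simp add: integrable_abs_iff)
qed

text \<open>Integration by parts: the closed support of \<phi> lies in the open interval, so \<phi>
  vanishes at 0 and \<open>l\<close> and no boundary terms remain.\<close>

lemma has_weak_deriv_of_deriv:
  assumes "0 < l" and f: "\<And>z. (f has_real_derivative f' z) (at z)" and f': "continuous_on UNIV f'"
  shows "has_weak_deriv l f f'"
  unfolding has_weak_deriv_def
proof (intro conjI ballI)
  have cf: "continuous_on UNIV f"
    using f by (intro DERIV_continuous_on) auto
  show "f \<in> L2 l" "f' \<in> L2 l"
    by (rule continuous_L2[OF assms(1)], fact)+
  fix \<phi> assume "\<phi> \<in> test_functions l"
  then have diff: "((deriv ^^ n) \<phi>) field_differentiable (at z)" and supp: "closure {z. \<phi> z \<noteq> 0} \<subseteq> {0<..<l}" for n z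
    by (auto simp: test_functions_def)
  have \<phi>: "(\<phi> has_real_derivative deriv \<phi> z) (at z)" for z
    using diff[of 0 z] by (simp add: DERIV_deriv_iff_field_differentiable)
  have "(deriv \<phi> has_real_derivative deriv (deriv \<phi>) z) (at z)" for z
    using diff[of 1 z] by (simp add: DERIV_deriv_iff_field_differentiable)
  then have c\<phi>': "continuous_on UNIV (deriv \<phi>)"
    by (intro DERIV_continuous_on) auto
  have c\<phi>: "continuous_on UNIV \<phi>"
    using \<phi> by (intro DERIV_continuous_on) auto
  have zero: "\<phi> 0 = 0" "\<phi> l = 0"
    using supp closure_subset[of "{z. \<phi> z \<noteq> 0}"] by (auto simp: subset_iff)
  have int: "integrable (Ioo_measure l) (\<lambda>z. f z * deriv \<phi> z)" "integrable (Ioo_measure l) (\<lambda>z. f' z * \<phi> z)"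
    by (intro continuous_integrable_Ioo assms(1) continuous_on_mult cf f' c\<phi> c\<phi>')+
  have "((\<lambda>z. f z * deriv \<phi> z + f' z * \<phi> z) has_integral (f l * \<phi> l - f 0 * \<phi> 0)) {0..l}"
  proof (rule fundamental_theorem_of_calculus)
    show "((\<lambda>z. f z * \<phi> z) has_vector_derivative f z * deriv \<phi> z + f' z * \<phi> z) (at z within {0..l})" for z
      using DERIV_mult[OF f[of z] \<phi>[of z]]
      by (auto simp: has_real_derivative_iff_has_vector_derivative[symmetric] mult.commute add.commute
          intro: DERIV_subset)
  qed (use assms(1) in simp)
  then have "integral {0<..<l} (\<lambda>z. f z * deriv \<phi> z + f' z * \<phi> z) = 0"
    unfolding zero integral_open_interval_real[symmetric] by (simp add: integral_unique)
  moreover have "(\<integral>z. f z * deriv \<phi> z + f' z * \<phi> z \<partial>Ioo_measure l) =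
      integral {0<..<l} (\<lambda>z. f z * deriv \<phi> z + f' z * \<phi> z)"
    by (intro lebesgue_integral_eq_integral Bochner_Integration.integrable_add int) simp
  ultimately show "(\<integral>z. f z * deriv \<phi> z \<partial>Ioo_measure l) = - (\<integral>z. f' z * \<phi> z \<partial>Ioo_measure l)"
    using int by simp
qed

text \<open>Uniqueness is the point: a competing continuous representative agrees with
  \<open>f\<close> on a closed set that has full measure in the open interval. Such a set contains
  the interval, hence its closure and the endpoints.\<close>

lemma pt_value_continuous:
  assumes "0 < l" "continuous_on UNIV f" "c \<in> {0..l}"
  shows "pt_value l f c = f c"
  unfolding pt_value_def
proof (rule the_equality)
  show "\<exists>g. continuous_on {0..l} g \<and> (AE z in Ioo_measure l. f z = g z) \<and> g c = f c"
    using continuous_on_subset[OF assms(2)] by (intro exI[of _ f]) auto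
next
  fix y assume "\<exists>g. continuous_on {0..l} g \<and> (AE z in Ioo_measure l. f z = g z) \<and> g c = y"
  then obtain g where g: "continuous_on {0..l} g" "AE z in Ioo_measure l. f z = g z" "g c = y"
    by blast
  define C where "C = {z \<in> {0..l}. f z = g z}"
  have "closed {z \<in> {0..l}. f z - g z = 0}"
    by (intro continuous_closed_preimage_constant continuous_on_diff
        continuous_on_subset[OF assms(2)] g(1)) auto
  then have "closed C" by (simp add: C_def)
  have "z \<in> C" if "z \<in> {0<..<l}" for z
  proof (rule mem_closed_if_AE_lebesgue_open[OF open_greaterThanLessThan \<open>closed C\<close> _ that])
    have "AE z in lebesgue. z \<in> {0<..<l} \<longrightarrow> f z = g z"
      using g(2) by (simp add: AE_restrict_space_iff)
    then show "AE z \<in> {0<..<l} in lebesgue. z \<in> C"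
      by eventually_elim (auto simp: C_def)
  qed
  then have "closure {0<..<l} \<subseteq> C"
    using \<open>closed C\<close> by (intro closure_minimal) auto
  with assms(1,3) g(3) show "y = f c"
    by (auto simp: C_def closure_greaterThanLessThan)
qed

text \<open>For classical functions the weak derivatives and boundary values are the usual ones, so
  membership reduces to four pointwise conditions.\<close>

lemma A_graph_classicalI:
  assumes "0 < l"
    and x: "\<And>z. (x has_real_derivative x' z) (at z)" "\<And>z. (x' has_real_derivative x'' z) (at z)"
      "continuous_on UNIV x''"
    and y: "\<And>z. (y has_real_derivative y' z) (at z)" "\<And>z. (y' has_real_derivative y'' z) (at z)"
      "continuous_on UNIV y''"
    and bc: "x' 0 = - \<kappa> * y 0" "y' 0 = - \<kappa> * y 0" "x' l = 0" "y' l = - \<gamma> * x l + \<gamma> * y l"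
  shows "((x, y), (\<lambda>z. D * x'' z, \<lambda>z. D * y'' z)) \<in> A_graph D l \<kappa> \<gamma>"
proof -
  have c: "continuous_on UNIV x" "continuous_on UNIV x'" "continuous_on UNIV y" "continuous_on UNIV y'"
    by (rule DERIV_continuous_on, rule has_field_derivative_at_within, rule x y)+
  note weak = has_weak_deriv_of_deriv[OF assms(1) x(1) c(2)] has_weak_deriv_of_deriv[OF assms(1) x(2,3)]
    has_weak_deriv_of_deriv[OF assms(1) y(1) c(4)] has_weak_deriv_of_deriv[OF assms(1) y(2,3)]
  have weak2: "has_weak_deriv2 l x x''" "has_weak_deriv2 l y y''"
    unfolding has_weak_deriv2_def using weak by blast+
  have pt: "pt_value l x' 0 = x' 0" "pt_value l x' l = x' l" "pt_value l y' 0 = y' 0"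
    "pt_value l y' l = y' l" "pt_value l x l = x l" "pt_value l y 0 = y 0" "pt_value l y l = y l"
    using assms(1) by (auto intro!: pt_value_continuous c)
  have "(x, y) \<in> A_dom l \<kappa> \<gamma>"
    unfolding A_dom_def H2_def using weak weak2 bc pt by auto
  moreover have "(\<lambda>z. D * x'' z) \<in> L2 l" "(\<lambda>z. D * y'' z) \<in> L2 l"
    by (intro continuous_L2 assms(1) continuous_on_mult continuous_on_const x(3) y(3))+
  ultimately show ?thesis
    unfolding A_graph_def using weak2 by auto
qed

text \<open>
  Since \<open>D * \<mu>\<^sup>2 = \<nu>\<close>, the first component is a strictly negative solution of \<open>\<nu> * x = D * x''\<close>,
  driven by the boundary value of the second one only; the constant \<open>k\<close> is what solves the
  boundary conditions for the second component.
\<close>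

lemma resolvent_datum:
  assumes "0 < D" "0 < l" "\<kappa> < 0" "\<gamma> < 0" "0 < \<nu>"
  shows "\<exists>u w. (u, w) \<in> A_graph D l \<kappa> \<gamma> \<and> AE_le l 0 (\<nu> *\<^sub>R u - w) \<and> (\<forall>z. fst u z < 0)"
proof -
  define \<mu> where "\<mu> = sqrt (\<nu> / D)"
  have \<mu>: "0 < \<mu>" "D * (\<mu> * \<mu>) = \<nu>"
    using assms by (simp_all add: \<mu>_def)
  define S C where "S = sinh (\<mu> * l)" and "C = cosh (\<mu> * l)"
  have SC: "0 < S" "1 \<le> C"
    using \<mu> assms by (simp_all add: S_def C_def cosh_real_ge_1)
  define d where "d = \<mu> * S - \<gamma> * (C - 1)"
  have d: "0 < d"
  proof -
    have "0 < \<mu> * S" "0 \<le> - \<gamma> * (C - 1)"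
      using \<mu> SC assms mult_nonpos_nonneg[of \<gamma> "C - 1"] by simp_all
    then show ?thesis by (simp add: d_def)
  qed
  \<comment> \<open>The condition y'(0) = x'(0) = \<mu> S fixes the coefficient of sinh in
    \<open>y\<close>, and y(0) = \<mu> S / (-\<kappa>) fixes \<alpha>. With x(l) = -1 the condition
    at \<open>l\<close> then becomes linear in \<open>k\<close>, with coefficient
    \<open>d\<close>.\<close>
  define k where "k = (\<mu> * S / (- \<kappa>) * (\<mu> * S - \<gamma> * C) + \<mu> * S * C - \<gamma> * S\<^sup>2 - \<gamma>) / d"
  have k_eq: "k * d = \<mu> * S / (- \<kappa>) * (\<mu> * S - \<gamma> * C) + \<mu> * S * C - \<gamma> * S\<^sup>2 - \<gamma>"
    using d by (simp add: k_def)
  \<comment> \<open>The signs of \<kappa> and \<gamma> make every summand nonnegative; the second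
    datum is the constant \<nu> k.\<close>
  have "0 \<le> \<mu> * S / (- \<kappa>) * (\<mu> * S + (- \<gamma>) * C) + \<mu> * S * C + (- \<gamma>) * S\<^sup>2 + (- \<gamma>)"
    using \<mu> SC assms by (intro add_nonneg_nonneg mult_nonneg_nonneg divide_nonneg_nonneg) auto
  then have k: "0 \<le> k"
    unfolding k_def using d by (intro divide_nonneg_pos) simp_all
  define \<alpha> where "\<alpha> = \<mu> * S / (- \<kappa>) - k"
  define x x' where "x z = - cosh (\<mu> * (l - z))" and "x' z = \<mu> * sinh (\<mu> * (l - z))" for z
  define y y' where "y z = k + \<alpha> * cosh (\<mu> * z) + S * sinh (\<mu> * z)"
    and "y' z = \<mu> * (\<alpha> * sinh (\<mu> * z) + S * cosh (\<mu> * z))" for z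
  define x'' y'' where "x'' z = \<mu> * \<mu> * x z" and "y'' z = \<mu> * \<mu> * (y z - k)" for z
  have "((x, y), (\<lambda>z. D * x'' z, \<lambda>z. D * y'' z)) \<in> A_graph D l \<kappa> \<gamma>"
  proof (rule A_graph_classicalI)
    show "(x has_real_derivative x' z) (at z)" "(x' has_real_derivative x'' z) (at z)"
      "(y has_real_derivative y' z) (at z)" "(y' has_real_derivative y'' z) (at z)" for z
      unfolding x_def[abs_def] x'_def[abs_def] y_def[abs_def] y'_def[abs_def] x''_def y''_def
      by (auto intro!: derivative_eq_intros simp: algebra_simps)
    show "continuous_on UNIV x''" "continuous_on UNIV y''"
      unfolding x_def[abs_def] y_def[abs_def] x''_def[abs_def] y''_def[abs_def]
      by (intro continuous_intros)+
    have "y 0 = \<mu> * S / (- \<kappa>)" by (simp add: y_def \<alpha>_def)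
    then show "x' 0 = - \<kappa> * y 0" "y' 0 = - \<kappa> * y 0"
      using assms by (simp_all add: x'_def y'_def S_def)
    show "x' l = 0" by (simp add: x'_def)
    have "\<alpha> * (\<mu> * S - \<gamma> * C) = \<mu> * S / (- \<kappa>) * (\<mu> * S - \<gamma> * C) - k * d + \<gamma> * k"
      by (simp add: \<alpha>_def d_def algebra_simps)
    also have "\<dots> = \<gamma> + \<gamma> * S\<^sup>2 - \<mu> * S * C + \<gamma> * k"
      by (simp add: k_eq)
    finally show "y' l = - \<gamma> * x l + \<gamma> * y l"
      by (simp add: x_def y_def y'_def algebra_simps power2_eq_square flip: S_def C_def)
  qed (rule assms)
  moreover have "AE_le l 0 (\<nu> *\<^sub>R (x, y) - (\<lambda>z. D * x'' z, \<lambda>z. D * y'' z))"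
    using assms k \<mu>(1) by (simp add: zero_le_mult_iff AE_le_def scaleR_fun_def x''_def y''_def algebra_simps flip: \<mu>(2))
  moreover have "\<forall>z. fst (x, y) z < 0"
    by (simp add: x_def)
  ultimately show ?thesis by blast
qed

theorem proposition12:
  fixes D\<^sub>a L \<kappa> \<gamma> :: real
    and T :: "real \<Rightarrow> (real \<Rightarrow> real) \<times> (real \<Rightarrow> real) \<Rightarrow> (real \<Rightarrow> real) \<times> (real \<Rightarrow> real)"
  assumes "D\<^sub>a > 0" and "L > 0"
    and "\<kappa> < 0" and "\<gamma> < 0" and "\<kappa> \<noteq> \<gamma>"
    and "c0_semigroup (L2 L \<times> L2 L) (L2_pair_norm L) T"
    and "generator (L2 L \<times> L2 L) (L2_pair_norm L) T = A_graph D\<^sub>a L \<kappa> \<gamma>"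
  shows "\<not> positive_semigroup L T"
proof
  assume "positive_semigroup L T"
  then interpret positive_L2_semigroup L T
    using assms by unfold_locales
  obtain M \<omega> where "0 \<le> M" "\<And>t u. 0 \<le> t \<Longrightarrow> u \<in> L2_pairs L \<Longrightarrow>
      L2_pair_norm L (T t u) \<le> M * exp (\<omega> * t) * L2_pair_norm L u"
    using exponential_growth by blast
  \<comment> \<open>\<open>\<bar>\<omega>\<bar> + 1\<close> is positive and exceeds \<omega>
    whatever the sign of \<omega>.\<close>
  moreover obtain u w where uw: "(u, w) \<in> A_graph D\<^sub>a L \<kappa> \<gamma>" "AE_le L 0 ((\<bar>\<omega>\<bar> + 1) *\<^sub>R u - w)"
    and neg: "\<And>z. fst u z < 0"
    using resolvent_datum[of D\<^sub>a L \<kappa> \<gamma> "\<bar>\<omega>\<bar> + 1"] assms(1-4)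
    by (metis abs_ge_zero add_nonneg_pos zero_less_one)
  ultimately have "AE_le L 0 u"
    using assms(7) by (intro nonneg_of_resolvent_nonneg[of M \<omega> u w "\<bar>\<omega>\<bar> + 1"]) auto
  then have "AE z in Ioo_measure L. 0 \<le> fst u z"
    by (simp add: AE_le_def)
  \<comment> \<open>\<open>fst u\<close> is negative everywhere, so the interval would have to be a
    null set.\<close>
  then have "AE z in Ioo_measure L. False"
    by eventually_elim (metis neg not_le)
  then have "emeasure (Ioo_measure L) {0<..<L} = 0"
    using AE_iff_measurable[of "{0<..<L}" "Ioo_measure L" "\<lambda>_. False"]
    by (auto simp: sets_restrict_space_iff greaterThanLessThan_eq greaterThan_def lessThan_def Int_def)
  with \<open>L > 0\<close> show False
    by (simp add: emeasure_restrict_space)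
qed

end
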